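(* Let $n\ge 2$ be an integer and let $G$ be a finite simple graph without odd components. If $G$ contains no $H_n$-factor, then there exists a nonempty subset $S\subset V(G)$ such that the subgraph $G-S$ has at least $2n|S|+1$ odd components each of which contains no $H_n$-factor.
   Context: For an integer $n\ge 2$, an $H_n$-factor of a graph $G$ is a spanning subgraph $F$ of $G$ such that $d_F(v)\in\{1,3,5,\ldots,2n-1,2n\}$ for every vertex $v\in V(G)$, where $d_F(v)$ is the degree of $v$ in $F$. For $S\subseteq V(G)$, $G-S$ denotes the subgraph obtained from $G$ by removing all vertices in $S$. An odd component is a connected component with an odd number of vertices. *)

theory Defs
  imports Main
begin

record 'a ugraph =
  verts :: "'a set"
  edges :: "'a set set"

definition simple_graph :: "'a ugraph \<Rightarrow> bool" where
  "simple_graph G \<longleftrightarrow> (\<forall>e\<in>edges G. e \<subseteq> verts G \<and> card e = 2)"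

definition finite_simple_graph :: "'a ugraph \<Rightarrow> bool" where
  "finite_simple_graph G \<longleftrightarrow> simple_graph G \<and> finite (verts G)"

definition subgraph :: "'a ugraph \<Rightarrow> 'a ugraph \<Rightarrow> bool" where
  "subgraph H G \<longleftrightarrow> simple_graph H \<and> verts H \<subseteq> verts G \<and> edges H \<subseteq> edges G"

definition spanning_subgraph :: "'a ugraph \<Rightarrow> 'a ugraph \<Rightarrow> bool" where
  "spanning_subgraph F G \<longleftrightarrow> subgraph F G \<and> verts F = verts G"

definition degree :: "'a ugraph \<Rightarrow> 'a \<Rightarrow> nat" where
  "degree G v = card {e \<in> edges G. v \<in> e}"

definition remove_verts :: "'a ugraph \<Rightarrow> 'a set \<Rightarrow> 'a ugraph" where
  "remove_verts G S =
     \<lparr>verts = verts G - S, edges = {e \<in> edges G. e \<inter> S = {}}\<rparr>"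

definition adj_rel :: "'a ugraph \<Rightarrow> ('a \<times> 'a) set" where
  "adj_rel G = {(u, v). {u, v} \<in> edges G}"

text \<open>The empty graph does not count as connected, so it is never a component.\<close>

definition connected_graph :: "'a ugraph \<Rightarrow> bool" where
  "connected_graph G \<longleftrightarrow>
     verts G \<noteq> {} \<and> (\<forall>u\<in>verts G. \<forall>v\<in>verts G. (u, v) \<in> (adj_rel G)\<^sup>*)"

text \<open>A component is a subgraph (not merely a vertex set) that is maximal among the
  connected subgraphs.\<close>

definition component_of :: "'a ugraph \<Rightarrow> 'a ugraph \<Rightarrow> bool" where
  "component_of C G \<longleftrightarrow>
     subgraph C G \<and> connected_graph C \<and>
     (\<forall>D. subgraph D G \<and> connected_graph D \<and> subgraph C D \<longrightarrow> D = C)"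

definition odd_component_of :: "'a ugraph \<Rightarrow> 'a ugraph \<Rightarrow> bool" where
  "odd_component_of C G \<longleftrightarrow> component_of C G \<and> odd (card (verts C))"

text \<open>The allowed degrees are \<open>1, 3, 5, \<dots>, 2n - 1\<close> and \<open>2n\<close>.\<close>

definition H_set :: "nat \<Rightarrow> nat set" where
  "H_set n = insert (2 * n) {k. odd k \<and> k \<le> 2 * n - 1}"

definition H_factor :: "nat \<Rightarrow> 'a ugraph \<Rightarrow> 'a ugraph \<Rightarrow> bool" where
  "H_factor n F G \<longleftrightarrow> spanning_subgraph F G \<and> (\<forall>v\<in>verts G. degree F v \<in> H_set n)"

definition has_H_factor :: "nat \<Rightarrow> 'a ugraph \<Rightarrow> bool" where
  "has_H_factor n G \<longleftrightarrow> (\<exists>F. H_factor n F G)"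

end

theory Submission
  imports Defs
begin

text \<open>
  The proof measures how far a spanning subgraph is from being an \<open>H\<^sub>n\<close>-factor.  Its cost is
  the sum over all vertices of the distance of the degree to the set \<open>{1, 3, \<dots>, 2n - 1, 2n}\<close>; a
  factor is a subgraph of cost \<open>0\<close>.  The real assertion (\<open>deficiency_attained\<close>) holds for every
  finite graph: if every spanning subgraph costs at least \<open>k\<close>, then some \<open>S\<close>, possibly empty, leaves at
  least \<open>k + 2n|S|\<close> odd components without a factor.  Taking \<open>k = 1\<close> gives the theorem, since the
  absence of odd components rules out \<open>S = {}\<close>.

  Everything is derived from exchanges between subgraphs of minimum cost, in the spirit of
  Lovasz's theory of degree constrained subgraphs.  Toggling an edge at a vertex with a forbidden
  degree, so that the degree moves towards the allowed set, gains \<open>1\<close> there; by minimality it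
  loses exactly \<open>1\<close> at the other end.  The defect thus moves along the edge, and the toggled
  subgraph is again of minimum cost.  The only neighbouring degrees with equal distance to the
  allowed set are \<open>2n - 1\<close> and \<open>2n\<close>, so a passing defect never carries a degree across the
  threshold between these two.  Choosing the edges from the symmetric difference with a second optimal
  subgraph brings the two closer together, and each of the main facts below follows by induction
  on the size of that difference:

  \<^item> If one optimal subgraph has a forbidden degree at \<open>u\<close>, then all optimal subgraphs have their
    degree at \<open>u\<close> on the same side of the threshold (\<open>same_side\<close>).

  \<^item> If some optimal subgraph has degree greater than \<open>2n\<close> at \<open>x\<close>, then deleting \<open>x\<close> increases
    the minimum cost by at least \<open>2n\<close> (\<open>exceeding_vertex_bound\<close>).

  \<^item> If no optimal subgraph has a degree greater than \<open>2n\<close>, then an optimal subgraph has at most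
    one forbidden degree in each component (\<open>one_bad_per_component\<close>, an analogue of Gallai's lemma
    on factor-critical graphs).

  The set \<open>S\<close> is now built by deleting vertices of the second kind as long as there are any.  When
  none is left, each defect of an optimal subgraph sits in a component of its own.  That component
  has no factor, because a factor could be substituted and would lower the cost.  It is odd by
  the handshake lemma: the defective vertex has even degree, and by \<open>same_side\<close> all other degrees
  in the component are below \<open>2n\<close>, hence odd.
\<close>

section \<open>Distance of a degree to the allowed set\<close>

definition deg :: "'a set set \<Rightarrow> 'a \<Rightarrow> nat" where
  "deg P v = card {e \<in> P. v \<in> e}"

definition gap :: "nat \<Rightarrow> nat \<Rightarrow> nat" where
  "gap n d = (if d > 2 * n then d - 2 * n else if odd d \<or> d = 2 * n then 0 else 1)"

definition toggle :: "'b \<Rightarrow> 'b set \<Rightarrow> 'b set" where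
  "toggle e P = (if e \<in> P then P - {e} else insert e P)"

lemma gap_eq_0_iff: "n \<ge> 1 \<Longrightarrow> gap n d = 0 \<longleftrightarrow> d \<in> H_set n"
  unfolding gap_def H_set_def
  by (cases "d = 2 * n"; cases "odd d"; cases "2 * n < d") simp_all

lemma gap_Suc_le: "gap n (Suc d) \<le> gap n d + 1"
  and gap_le_Suc: "gap n d \<le> gap n (Suc d) + 1"
  unfolding gap_def by auto

text \<open>The degrees \<open>2n - 1\<close> and \<open>2n\<close> are both allowed, so a step between them leaves the distance
  unchanged; every other step by one changes it.  This is the property of the allowed set that
  drives the whole proof.\<close>

lemma gap_change_same_side:
  assumes "a = Suc b \<or> b = Suc a" "gap n a = gap n b + 1"
  shows "a < 2 * n \<longleftrightarrow> b < 2 * n"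
proof (rule ccontr)
  assume "\<not> ?thesis"
  then have "{a, b} = {2 * n - 1, 2 * n} \<and> n > 0" using assms(1) by auto
  moreover have "gap n (2 * n - 1) = 0" "gap n (2 * n) = 0" if "n > 0"
    using that by (simp_all add: gap_def)
  ultimately show False using assms(2) by (auto simp: doubleton_eq_iff)
qed

text \<open>From a forbidden degree every step down helps, including a step from an even degree below
  \<open>2n\<close>; a step up helps only below \<open>2n\<close>.\<close>

lemma gap_down: "gap n a > 0 \<Longrightarrow> 0 < a \<Longrightarrow> gap n (a - 1) + 1 = gap n a"
  unfolding gap_def by (auto split: if_splits)

lemma gap_up: "gap n a > 0 \<Longrightarrow> a < 2 * n \<Longrightarrow> gap n (Suc a) + 1 = gap n a"
  unfolding gap_def by (auto split: if_splits)

lemma gap_bigger_below: "gap n b < gap n a \<Longrightarrow> a < b \<Longrightarrow> a < 2 * n"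
  unfolding gap_def by (auto split: if_splits)

lemma gap_low: "gap n a > 0 \<Longrightarrow> a \<le> 2 * n \<Longrightarrow> a < 2 * n \<and> even a \<and> gap n a = 1"
  unfolding gap_def by (auto split: if_splits)

section \<open>Passing a defect along an edge\<close>

locale finite_graph =
  fixes G :: "'a ugraph" and n :: nat
  assumes graph: "finite_simple_graph G"
begin

abbreviation V :: "'a set" where "V \<equiv> verts G"

abbreviation E :: "'a set set" where "E \<equiv> edges G"

lemma finite_V: "finite V"
  and edge_subset: "e \<in> E \<Longrightarrow> e \<subseteq> V"
  and card_edge: "e \<in> E \<Longrightarrow> card e = 2"
  using graph by (auto simp: finite_simple_graph_def simple_graph_def)

text \<open>The weight may depend on the vertex: the proof of \<open>exceeding_vertex_bound\<close> counts the plain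
  degree at one vertex and the distance to the allowed set elsewhere.\<close>

definition cost :: "('a \<Rightarrow> nat \<Rightarrow> nat) \<Rightarrow> 'a set set \<Rightarrow> nat" where
  "cost c P = (\<Sum>v\<in>V. c v (deg P v))"

definition optimal :: "('a \<Rightarrow> nat \<Rightarrow> nat) \<Rightarrow> 'a set set \<Rightarrow> bool" where
  "optimal c P \<longleftrightarrow> P \<subseteq> E \<and> (\<forall>Q. Q \<subseteq> E \<longrightarrow> cost c P \<le> cost c Q)"

definition unit_steps :: "('a \<Rightarrow> nat \<Rightarrow> nat) \<Rightarrow> bool" where
  "unit_steps c \<longleftrightarrow> (\<forall>v d. c v (Suc d) \<le> c v d + 1 \<and> c v d \<le> c v (Suc d) + 1)"

lemma finite_E: "finite E"
  using finite_V edge_subset by (meson PowI finite_Pow_iff finite_subset subsetI)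

lemma finite_sub: "P \<subseteq> E \<Longrightarrow> finite P"
  using finite_E finite_subset by blast

lemma optimal_sub: "optimal c P \<Longrightarrow> P \<subseteq> E"
  by (simp add: optimal_def)

lemma optimal_cost_eq: "optimal c P \<Longrightarrow> optimal c Q \<Longrightarrow> cost c P = cost c Q"
  unfolding optimal_def by (meson antisym)

lemma optimal_exists: "\<exists>P. optimal c P"
proof -
  have "\<exists>P. P \<subseteq> E \<and> (\<forall>Q. Q \<subseteq> E \<longrightarrow> cost c P \<le> cost c Q)"
    using ex_has_least_nat[of "\<lambda>P. P \<subseteq> E" "{}" "cost c"] by auto
  then show ?thesis by (simp add: optimal_def)
qed

lemma unit_steps_gap: "unit_steps (\<lambda>_. gap n)"
  unfolding unit_steps_def using gap_Suc_le gap_le_Suc by blast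

lemma edge_ends: "{x, y} \<in> E \<Longrightarrow> x \<in> V \<and> y \<in> V \<and> x \<noteq> y"
  using edge_subset[of "{x, y}"] card_edge[of "{x, y}"] by auto

lemma edge_at:
  assumes "e \<in> E" "x \<in> e"
  obtains y where "e = {x, y}" "y \<noteq> x"
proof -
  from card_edge[OF assms(1)] obtain a b where "e = {a, b}" "a \<noteq> b"
    by (auto simp: card_2_iff)
  with assms(2) that show thesis by (metis insertE insert_commute singletonD)
qed

lemma deg_toggle_other: "v \<notin> e \<Longrightarrow> deg (toggle e P) v = deg P v"
proof -
  assume "v \<notin> e"
  then have "{f \<in> toggle e P. v \<in> f} = {f \<in> P. v \<in> f}"
    by (auto simp: toggle_def)
  then show ?thesis by (simp add: deg_def)
qed

lemma deg_toggle_end: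
  assumes "finite P" "v \<in> e"
  shows "e \<in> P \<Longrightarrow> deg P v = Suc (deg (toggle e P) v)"
    and "e \<notin> P \<Longrightarrow> deg (toggle e P) v = Suc (deg P v)"
proof -
  assume e: "e \<in> P"
  then have *: "{f \<in> P. v \<in> f} = insert e {f \<in> toggle e P. v \<in> f}"
    using assms by (auto simp: toggle_def)
  show "deg P v = Suc (deg (toggle e P) v)"
    unfolding deg_def * by (subst card_insert_disjoint) (use assms e in \<open>auto simp: toggle_def\<close>)
next
  assume e: "e \<notin> P"
  then have *: "{f \<in> toggle e P. v \<in> f} = insert e {f \<in> P. v \<in> f}"
    using assms by (auto simp: toggle_def)
  show "deg (toggle e P) v = Suc (deg P v)"
    unfolding deg_def * by (subst card_insert_disjoint) (use assms e in auto)
qed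

lemma toggle_sub: "P \<subseteq> E \<Longrightarrow> e \<in> E \<Longrightarrow> toggle e P \<subseteq> E"
  by (auto simp: toggle_def)

lemma deg_toggle_adjacent:
  assumes "finite P" "v \<in> e"
  shows "deg P v = Suc (deg (toggle e P) v) \<or> deg (toggle e P) v = Suc (deg P v)"
  using deg_toggle_end[OF assms] by blast

lemma sum_split2:
  fixes g :: "'a \<Rightarrow> nat"
  assumes "x \<in> V" "y \<in> V" "x \<noteq> y"
  shows "sum g V = g x + g y + sum g (V - {x, y})"
proof -
  have "sum g V = g x + sum g (V - {x})"
    using assms finite_V by (simp add: sum.remove)
  also have "sum g (V - {x}) = g y + sum g (V - {x} - {y})"
    using assms finite_V by (simp add: sum.remove)
  also have "V - {x} - {y} = V - {x, y}" by auto
  finally show ?thesis by simp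
qed

text \<open>Minimality forces a gain of one at \<open>x\<close> to be paid for by a loss of at least one at \<open>y\<close>, and
  a weight with unit steps cannot lose more.\<close>

lemma toggle_optimal:
  assumes c: "unit_steps c" and P: "optimal c P" and e: "{x, y} \<in> E"
    and better: "c x (deg (toggle {x, y} P) x) + 1 = c x (deg P x)"
  shows "optimal c (toggle {x, y} P)"
    and "c y (deg (toggle {x, y} P) y) = c y (deg P y) + 1"
proof -
  let ?P = "toggle {x, y} P"
  have xy: "x \<in> V" "y \<in> V" "x \<noteq> y" using edge_ends[OF e] by auto
  have sub: "?P \<subseteq> E" using toggle_sub[OF optimal_sub[OF P] e] .
  have fin: "finite P" using P finite_sub optimal_sub by blast
  have rest: "(\<Sum>v\<in>V - {x, y}. c v (deg ?P v)) = (\<Sum>v\<in>V - {x, y}. c v (deg P v))"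
    by (rule sum.cong) (auto simp: deg_toggle_other)
  have le: "cost c P \<le> cost c ?P" using P sub by (simp add: optimal_def)
  have y: "c y (deg ?P y) \<le> c y (deg P y) + 1"
    using deg_toggle_adjacent[OF fin, of y "{x, y}"] c by (auto simp: unit_steps_def)
  note split = sum_split2[OF xy]
  show 1: "c y (deg ?P y) = c y (deg P y) + 1"
    using le y better rest unfolding cost_def split by linarith
  have "cost c ?P = cost c P"
    using 1 better rest unfolding cost_def split by linarith
  then show "optimal c ?P" using P sub by (simp add: optimal_def)
qed

text \<open>The effect of toggling an edge \<open>{x, y}\<close> that passes a unit of weight from \<open>x\<close> to \<open>y\<close>, stated
  through degrees so that the edge itself can be forgotten.\<close>

definition passes ::
  "('a \<Rightarrow> nat \<Rightarrow> nat) \<Rightarrow> 'a set set \<Rightarrow> 'a \<Rightarrow> 'a set set \<Rightarrow> 'a \<Rightarrow> bool" where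
  "passes c P x P' y \<longleftrightarrow> optimal c P' \<and> y \<in> V \<and> y \<noteq> x \<and>
    c x (deg P' x) + 1 = c x (deg P x) \<and> c y (deg P' y) = c y (deg P y) + 1 \<and>
    (\<forall>w\<in>{x, y}. deg P w = Suc (deg P' w) \<or> deg P' w = Suc (deg P w)) \<and>
    (\<forall>w. w \<noteq> x \<longrightarrow> w \<noteq> y \<longrightarrow> deg P' w = deg P w)"

lemma passes_edge:
  assumes c: "unit_steps c" and P: "optimal c P" and e: "{x, y} \<in> E"
    and better: "c x (deg (toggle {x, y} P) x) + 1 = c x (deg P x)"
  shows "passes c P x (toggle {x, y} P) y"
proof -
  have fin: "finite P" using P finite_sub optimal_sub by blast
  have "\<forall>w\<in>{x, y}. deg P w = Suc (deg (toggle {x, y} P) w) \<or>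
      deg (toggle {x, y} P) w = Suc (deg P w)"
    using deg_toggle_adjacent[OF fin] by blast
  moreover have "\<forall>w. w \<noteq> x \<longrightarrow> w \<noteq> y \<longrightarrow> deg (toggle {x, y} P) w = deg P w"
    using deg_toggle_other[of _ "{x, y}" P] by auto
  ultimately show ?thesis
    using toggle_optimal[OF assms] edge_ends[OF e] better unfolding passes_def by metis
qed

text \<open>If \<open>P\<close> and \<open>Q\<close> have different degrees at \<open>x\<close>, the larger one has an edge at \<open>x\<close> that the
  other lacks.  Toggling it in \<open>P\<close> moves the degree of \<open>P\<close> towards that of \<open>Q\<close>, which helps at a
  forbidden degree unless it leads upwards from beyond \<open>2n\<close>.\<close>

lemma step_towards:
  assumes c: "unit_steps c" "c x = gap n" and P: "optimal c P" and Q: "Q \<subseteq> E"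
    and bad: "gap n (deg P x) > 0" and neq: "deg P x \<noteq> deg Q x"
    and low: "deg P x < deg Q x \<Longrightarrow> deg P x < 2 * n"
  shows "\<exists>P' y. passes c P x P' y \<and> card (sym_diff P' Q) < card (sym_diff P Q)"
proof -
  have fin: "finite P" "finite Q" using P Q finite_sub optimal_sub by blast+
  have finx: "finite {e \<in> P. x \<in> e}" "finite {e \<in> Q. x \<in> e}" using fin by auto
  have "\<exists>e. e \<in> sym_diff P Q \<and> x \<in> e \<and> (e \<in> P \<longleftrightarrow> deg Q x < deg P x)"
  proof (cases "deg Q x < deg P x")
    case True
    then have "\<not> {e \<in> P. x \<in> e} \<subseteq> {e \<in> Q. x \<in> e}"
      unfolding deg_def using card_mono[OF finx(2)] by (meson not_less)
    then show ?thesis using True by auto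
  next
    case False
    then have "deg P x < deg Q x" using neq by simp
    then have "\<not> {e \<in> Q. x \<in> e} \<subseteq> {e \<in> P. x \<in> e}"
      unfolding deg_def using card_mono[OF finx(1)] by (meson not_less)
    then show ?thesis using False by auto
  qed
  then obtain e where e: "e \<in> sym_diff P Q" "x \<in> e" "e \<in> P \<longleftrightarrow> deg Q x < deg P x" by blast
  have eE: "e \<in> E" using e P Q optimal_sub by blast
  obtain y where y: "e = {x, y}" "y \<noteq> x" using edge_at[OF eE e(2)] .
  let ?P = "toggle {x, y} P"
  have better: "c x (deg ?P x) + 1 = c x (deg P x)"
  proof (cases "e \<in> P")
    case True
    then show ?thesis
      using deg_toggle_end(1)[OF fin(1) e(2) True] gap_down[OF bad] y(1) c(2) by simp
  next
    case False
    then have "deg P x < 2 * n" using e(3) neq low by simp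
    then show ?thesis
      using deg_toggle_end(2)[OF fin(1) e(2) False] gap_up[OF bad] y(1) c(2) by simp
  qed
  have "sym_diff ?P Q = sym_diff P Q - {e}"
    using e(1) y(1) by (auto simp: toggle_def)
  then have "card (sym_diff ?P Q) < card (sym_diff P Q)"
    using e(1) fin by (metis card_Diff1_less finite_Diff finite_UnI)
  then show ?thesis using passes_edge[OF c(1) P _ better] eE y(1) by blast
qed

lemma step_towards_better:
  assumes c: "unit_steps c" "c x = gap n" and P: "optimal c P" and Q: "Q \<subseteq> E"
    and less: "gap n (deg Q x) < gap n (deg P x)"
  shows "\<exists>P' y. passes c P x P' y \<and> card (sym_diff P' Q) < card (sym_diff P Q)"
proof (rule step_towards[OF c P Q])
  show "0 < gap n (deg P x)" using less by simp
  show "deg P x \<noteq> deg Q x" using less by auto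
  show "deg P x < deg Q x \<Longrightarrow> deg P x < 2 * n" using gap_bigger_below[OF less] .
qed

section \<open>Forbidden degrees stay on one side of the threshold\<close>

abbreviation gap_optimal :: "'a set set \<Rightarrow> bool" where
  "gap_optimal \<equiv> optimal (\<lambda>_. gap n)"

lemma cost_eq_exchange:
  assumes "gap_optimal P" "gap_optimal Q" "u \<in> V" "gap n (deg Q u) < gap n (deg P u)"
  shows "\<exists>x\<in>V. gap n (deg P x) < gap n (deg Q x)"
proof (rule ccontr)
  assume "\<not> ?thesis"
  then have "\<forall>x\<in>V. gap n (deg Q x) \<le> gap n (deg P x)" by (simp add: not_less)
  then have "cost (\<lambda>_. gap n) Q < cost (\<lambda>_. gap n) P"
    unfolding cost_def using assms finite_V by (intro sum_strict_mono_ex1) auto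
  then show False using optimal_cost_eq[OF assms(1,2)] by simp
qed

text \<open>A pair \<open>P\<close>, \<open>Q\<close> that disagrees about the side at \<open>u\<close> yields another such pair with smaller
  symmetric difference.  If \<open>Q\<close> is also forbidden at \<open>u\<close>, the defect of \<open>P\<close> is pushed away from
  \<open>u\<close>, and \<open>Q\<close> takes over the role of \<open>P\<close>.  Otherwise equality of the costs provides a vertex
  \<open>x \<noteq> u\<close> where \<open>Q\<close> is worse than \<open>P\<close>, and the defect of \<open>Q\<close> at \<open>x\<close> is pushed towards \<open>P\<close>.  No
  push crosses the threshold at \<open>u\<close>, even if the defect arrives there.\<close>

lemma same_side:
  assumes "gap_optimal P" "gap_optimal Q" "u \<in> V" "gap n (deg P u) > 0"
  shows "deg P u < 2 * n \<longleftrightarrow> deg Q u < 2 * n"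
  using assms
proof (induction "card (sym_diff P Q)" arbitrary: P Q rule: less_induct)
  case less
  note P = less.prems(1) and Q = less.prems(2) and u = less.prems(3) and bad = less.prems(4)
  show ?case
  proof (rule ccontr)
    assume sides: "\<not> ?thesis"
    show False
    proof (cases "gap n (deg Q u) > 0")
      case True
      have "deg P u \<noteq> deg Q u" "deg P u < deg Q u \<Longrightarrow> deg P u < 2 * n"
        using sides by linarith+
      then obtain P' y where pass: "passes (\<lambda>_. gap n) P u P' y"
        and smaller: "card (sym_diff P' Q) < card (sym_diff P Q)"
        using step_towards[OF unit_steps_gap refl P optimal_sub[OF Q] bad] by blast
      then have P': "gap_optimal P'" "gap n (deg P u) = gap n (deg P' u) + 1"
        "deg P u = Suc (deg P' u) \<or> deg P' u = Suc (deg P u)"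
        by (auto simp: passes_def)
      have "deg P u < 2 * n \<longleftrightarrow> deg P' u < 2 * n"
        using gap_change_same_side[OF P'(3,2)] .
      moreover have "deg Q u < 2 * n \<longleftrightarrow> deg P' u < 2 * n"
        using less.hyps[of Q P'] smaller P' Q u True by (simp add: Un_commute)
      ultimately show False using sides by simp
    next
      case False
      then obtain x where x: "x \<in> V" "gap n (deg P x) < gap n (deg Q x)"
        using cost_eq_exchange[OF P Q u] bad by auto
      then have xu: "x \<noteq> u" using False by auto
      obtain Q' y where pass: "passes (\<lambda>_. gap n) Q x Q' y"
        and smaller: "card (sym_diff Q' P) < card (sym_diff Q P)"
        using step_towards_better[OF unit_steps_gap refl Q optimal_sub[OF P] x(2)] by blast
      then have Q': "gap_optimal Q'" "gap n (deg Q' y) = gap n (deg Q y) + 1"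
        "deg Q' y = Suc (deg Q y) \<or> deg Q y = Suc (deg Q' y)"
        "u \<noteq> y \<Longrightarrow> deg Q' u = deg Q u"
        using xu by (auto simp: passes_def)
      have "deg Q' u < 2 * n \<longleftrightarrow> deg Q u < 2 * n"
        using Q'(4) gap_change_same_side[OF Q'(3,2)] by (cases "u = y") auto
      moreover have "deg P u < 2 * n \<longleftrightarrow> deg Q' u < 2 * n"
        using less.hyps[of P Q'] smaller P Q' u bad by (simp add: Un_commute)
      ultimately show False using sides by simp
    qed
  qed
qed

section \<open>Deleting a vertex of excessive degree\<close>

definition linear_at :: "'a \<Rightarrow> 'a \<Rightarrow> nat \<Rightarrow> nat" where
  "linear_at x v d = (if v = x then d else gap n d)"

lemma unit_steps_linear_at: "unit_steps (linear_at x)"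
  unfolding unit_steps_def linear_at_def using gap_Suc_le gap_le_Suc by auto

lemma cost_linear_at:
  assumes "x \<in> V"
  shows "cost (linear_at x) P + gap n (deg P x) = cost (\<lambda>_. gap n) P + deg P x"
proof -
  have "(\<Sum>v\<in>V - {x}. linear_at x v (deg P v)) = (\<Sum>v\<in>V - {x}. gap n (deg P v))"
    by (rule sum.cong) (auto simp: linear_at_def)
  moreover have "linear_at x x (deg P x) = deg P x" by (simp add: linear_at_def)
  ultimately show ?thesis
    unfolding cost_def sum.remove[OF finite_V assms] by simp
qed

text \<open>The contradiction comes from a subgraph \<open>P\<close> that is optimal for the modified weight and too
  cheap, and an ordinary optimal subgraph \<open>T\<close>.  As long as \<open>T\<close> exceeds \<open>2n\<close> at \<open>x\<close>, a vertex where
  \<open>P\<close> is worse lets \<open>P\<close> move closer to \<open>T\<close>.  If there is none and \<open>T\<close> is nowhere worse off \<open>x\<close>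
  either, then \<open>T\<close> pushes a defect out of \<open>x\<close>, which makes it worse than \<open>P\<close> at one vertex.  From
  then on \<open>T\<close> dominates \<open>P\<close> off \<open>x\<close>, strictly somewhere, so that it can always push a defect towards
  \<open>P\<close>.  The domination survives until a defect arrives at \<open>x\<close> again, where by \<open>same_side\<close> it can
  only show up as a degree greater than \<open>2n\<close>.  The disjunction in the last hypothesis is what this
  process preserves while the symmetric difference shrinks.\<close>

lemma exceeding_vertex_no_linear_optimum:
  assumes x: "x \<in> V" and T0: "gap_optimal T0" "deg T0 x > 2 * n"
    and P: "optimal (linear_at x) P" "cost (linear_at x) P < cost (\<lambda>_. gap n) T0 + 2 * n"
    and T: "gap_optimal T"
    and config: "deg T x > 2 * n \<or>
      (\<forall>w\<in>V - {x}. gap n (deg P w) \<le> gap n (deg T w)) \<and>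
      (\<exists>w\<in>V - {x}. gap n (deg P w) < gap n (deg T w))"
  shows False
  using P T config
proof (induction "card (sym_diff P T)" arbitrary: P T rule: less_induct)
  case less
  note P = less.prems(1) and Pc = less.prems(2) and T = less.prems(3)
  have gT0: "gap n (deg T0 x) > 0" using T0(2) by (simp add: gap_def)
  show False
  proof (cases "(\<forall>w\<in>V - {x}. gap n (deg P w) \<le> gap n (deg T w)) \<and>
      (\<exists>w\<in>V - {x}. gap n (deg P w) < gap n (deg T w))")
    case True
    then obtain y where y: "y \<in> V" "y \<noteq> x" "gap n (deg P y) < gap n (deg T y)" by auto
    obtain T' z where pass: "passes (\<lambda>_. gap n) T y T' z"
      and "card (sym_diff T' P) < card (sym_diff T P)"
      using step_towards_better[OF unit_steps_gap refl T optimal_sub[OF P] y(3)] by blast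
    then have smaller: "card (sym_diff P T') < card (sym_diff P T)"
      by (simp add: Un_commute)
    have T': "gap_optimal T'" "z \<in> V" "z \<noteq> y"
      "gap n (deg T' y) + 1 = gap n (deg T y)"
      "gap n (deg T' z) = gap n (deg T z) + 1"
      "\<And>w. w \<noteq> y \<Longrightarrow> w \<noteq> z \<Longrightarrow> deg T' w = deg T w"
      using pass by (auto simp: passes_def)
    show False
    proof (cases "z = x")
      case True
      then have "gap n (deg T' x) > 0" using T'(5) by simp
      moreover have "\<not> deg T' x < 2 * n"
        using same_side[OF T0(1) T'(1) x gT0] T0(2) by simp
      ultimately have "deg T' x > 2 * n" using gap_low by (meson not_less)
      then show False using less.hyps[OF smaller P Pc T'(1)] by blast
    next
      case z: False
      have "\<forall>w\<in>V - {x}. gap n (deg P w) \<le> gap n (deg T' w)"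
      proof
        fix w assume w: "w \<in> V - {x}"
        then have "gap n (deg P w) \<le> gap n (deg T w)" using True by blast
        then show "gap n (deg P w) \<le> gap n (deg T' w)"
          using T'(3-6) y(3) by (cases "w = y"; cases "w = z") auto
      qed
      moreover have "gap n (deg P z) < gap n (deg T' z)"
      proof -
        have "gap n (deg P z) \<le> gap n (deg T z)" using True T'(2) z by blast
        then show ?thesis using T'(5) by simp
      qed
      ultimately show False using less.hyps[OF smaller P Pc T'(1)] T'(2) z by blast
    qed
  next
    case notdom: False
    then have over: "deg T x > 2 * n" using less.prems(4) by blast
    show False
    proof (cases "\<exists>z\<in>V - {x}. gap n (deg T z) < gap n (deg P z)")
      case True
      then obtain z where z: "z \<in> V" "z \<noteq> x" "gap n (deg T z) < gap n (deg P z)" by auto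
      have lz: "linear_at x z = gap n" using z by (simp add: linear_at_def fun_eq_iff)
      obtain P' y where "passes (linear_at x) P z P' y"
        and smaller: "card (sym_diff P' T) < card (sym_diff P T)"
        using step_towards_better[OF unit_steps_linear_at lz P optimal_sub[OF T] z(3)] by blast
      then have P': "optimal (linear_at x) P'" by (simp add: passes_def)
      have "cost (linear_at x) P' < cost (\<lambda>_. gap n) T0 + 2 * n"
        using optimal_cost_eq[OF P P'] Pc by simp
      then show False using less.hyps[OF smaller P' _ T] over by blast
    next
      case False
      then have eq: "\<forall>w\<in>V - {x}. gap n (deg P w) = gap n (deg T w)"
        using notdom by (metis linorder_neqE_nat not_less)
      \<comment> \<open>At degree \<open>2n\<close> or more the modified weight exceeds the ordinary one by exactly \<open>2n\<close>, and then
          \<open>P\<close> would be cheaper than the optimum.\<close>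
      have "deg P x < 2 * n"
      proof (rule ccontr)
        assume "\<not> deg P x < 2 * n"
        then have "gap n (deg P x) + 2 * n = deg P x" by (auto simp: gap_def)
        moreover have "cost (\<lambda>_. gap n) T0 \<le> cost (\<lambda>_. gap n) P"
          using T0(1) optimal_sub[OF P] by (simp add: optimal_def)
        ultimately show False using cost_linear_at[OF x, of P] Pc by linarith
      qed
      then have lt: "deg P x < deg T x" using over by simp
      have bad: "gap n (deg T x) > 0" using over by (simp add: gap_def)
      obtain T' y where pass: "passes (\<lambda>_. gap n) T x T' y"
        and "card (sym_diff T' P) < card (sym_diff T P)"
        using step_towards[OF unit_steps_gap refl T optimal_sub[OF P] bad] lt by force
      then have "card (sym_diff P T') < card (sym_diff P T)"
        by (simp add: Un_commute)
      moreover have T': "gap_optimal T'" "y \<in> V" "y \<noteq> x"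
        "gap n (deg T' y) = gap n (deg T y) + 1"
        "\<And>w. w \<noteq> x \<Longrightarrow> w \<noteq> y \<Longrightarrow> deg T' w = deg T w"
        using pass by (auto simp: passes_def)
      moreover have "\<forall>w\<in>V - {x}. gap n (deg P w) \<le> gap n (deg T' w)"
      proof
        fix w assume "w \<in> V - {x}"
        then show "gap n (deg P w) \<le> gap n (deg T' w)"
          using eq T'(4,5) by (cases "w = y") auto
      qed
      moreover have "gap n (deg P y) < gap n (deg T' y)"
        using eq T'(2-4) by simp
      ultimately show False using less.hyps[OF _ P Pc T'(1)] T'(2,3) by blast
    qed
  qed
qed

text \<open>A spanning subgraph that avoids \<open>x\<close> has degree \<open>0\<close> there, so its modified cost is its cost in
  the graph without \<open>x\<close>: deleting \<open>x\<close> raises the minimum cost by \<open>2n\<close> or more.\<close>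

lemma exceeding_vertex_bound:
  assumes x: "x \<in> V" and T: "gap_optimal T" "deg T x > 2 * n" and P: "P \<subseteq> E"
  shows "cost (\<lambda>_. gap n) T + 2 * n \<le> cost (linear_at x) P"
proof -
  obtain R where R: "optimal (linear_at x) R" using optimal_exists by blast
  then have "cost (\<lambda>_. gap n) T + 2 * n \<le> cost (linear_at x) R"
    using exceeding_vertex_no_linear_optimum[OF x T R _ T(1)] T(2) by (meson not_less)
  also have "\<dots> \<le> cost (linear_at x) P" using R P by (simp add: optimal_def)
  finally show ?thesis .
qed

section \<open>Defects when no degree is excessive\<close>

text \<open>Without degrees greater than \<open>2n\<close>, a forbidden degree is even and any change by one repairs it.
  Toggling the edge between two forbidden degrees would repair both; toggling it at a single one
  passes the defect to the neighbour.\<close>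

lemma bad_neighbour:
  assumes bounded: "\<And>Q v. gap_optimal Q \<Longrightarrow> v \<in> V \<Longrightarrow> deg Q v \<le> 2 * n"
    and P: "gap_optimal P" and bad: "gap n (deg P v) > 0" and e: "{v, t} \<in> E"
  shows "gap n (deg P t) = 0" and "\<exists>Q. gap_optimal Q \<and> gap n (deg Q t) > 0"
proof -
  have vt: "v \<in> V" "t \<in> V" using edge_ends[OF e] by auto
  have fin: "finite P" using P finite_sub optimal_sub by blast
  let ?Q = "toggle {v, t} P"
  have better: "gap n (deg ?Q w) + 1 = gap n (deg P w)"
    if "gap n (deg P w) > 0" "w \<in> {v, t}" for w
  proof -
    have "deg P w < 2 * n" using that gap_low bounded[OF P] vt by blast
    then show ?thesis
      using deg_toggle_end[OF fin that(2)] gap_up[OF that(1)] gap_down[OF that(1)]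
      by (cases "{v, t} \<in> P") auto
  qed
  note Q = toggle_optimal[OF unit_steps_gap P e better[OF bad]]
  show "gap n (deg P t) = 0" using better[of t] Q(2) by force
  show "\<exists>Q. gap_optimal Q \<and> gap n (deg Q t) > 0" using Q by force
qed

lemma reachable_bad:
  assumes bounded: "\<And>Q v. gap_optimal Q \<Longrightarrow> v \<in> V \<Longrightarrow> deg Q v \<le> 2 * n"
    and P: "gap_optimal P" and bad: "gap n (deg P v) > 0" and r: "(v, w) \<in> (adj_rel G)\<^sup>*"
  shows "\<exists>Q. gap_optimal Q \<and> gap n (deg Q w) > 0"
  using r
proof (induction rule: rtrancl_induct)
  case base
  show ?case using P bad by blast
next
  case (step y z)
  then obtain Q where "gap_optimal Q" "gap n (deg Q y) > 0" by blast
  then show ?case using bad_neighbour(2)[OF bounded] step(2) by (auto simp: adj_rel_def)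
qed

text \<open>Gallai's argument, by induction along a walk from \<open>v\<close> to \<open>w\<close> whose second vertex is \<open>t\<close>.
  Suppose that \<open>P\<close> is defective at \<open>v\<close> and \<open>w\<close>.  The defect at \<open>v\<close> can be passed to \<open>t\<close>, so some
  optimal \<open>Q\<close> is defective at \<open>t\<close>; it is allowed at \<open>v\<close>, a neighbour of \<open>t\<close>, and at \<open>w\<close>, by
  induction.  Likewise \<open>P\<close> is allowed at \<open>t\<close>.  The costs being equal, \<open>Q\<close> must make up for this
  by being worse than \<open>P\<close> at some vertex other than \<open>t\<close>, and the defect there can be pushed towards \<open>P\<close>
  while \<open>Q\<close> stays defective at \<open>t\<close>.\<close>

lemma one_bad_per_component:
  assumes bounded: "\<And>Q v. gap_optimal Q \<Longrightarrow> v \<in> V \<Longrightarrow> deg Q v \<le> 2 * n"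
    and r: "(v, w) \<in> (adj_rel G)\<^sup>*" and "v \<in> V" "w \<in> V" "v \<noteq> w"
    and "gap_optimal P" "gap n (deg P v) > 0"
  shows "gap n (deg P w) = 0"
  using r assms(3-)
proof (induction arbitrary: P rule: converse_rtrancl_induct)
  case base
  then show ?case by simp
next
  case (step v t)
  have e: "{v, t} \<in> E" using step(1) by (simp add: adj_rel_def)
  have tV: "t \<in> V" using edge_ends[OF e] by simp
  show ?case
  proof (cases "t = w")
    case True
    then show ?thesis using bad_neighbour(1)[OF bounded] step.prems e by blast
  next
    case tw: False
    have no_pair: "gap n (deg P w) = 0"
      if "gap_optimal P" "gap n (deg P v) > 0" "gap_optimal Q" "gap n (deg Q t) > 0" for P Q
      using that
    proof (induction "card (sym_diff P Q)" arbitrary: Q rule: less_induct)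
      case less
      note P = less.prems(1) and Pv = less.prems(2) and Q = less.prems(3) and Qt = less.prems(4)
      have Pt: "gap n (deg P t) = 0" using bad_neighbour(1)[OF bounded P Pv e] .
      have Qv: "gap n (deg Q v) = 0"
        using bad_neighbour(1)[OF bounded Q Qt] e by (simp add: insert_commute)
      have Qw: "gap n (deg Q w) = 0"
        using step.IH[OF tV step.prems(2) tw Q Qt] .
      show ?case
      proof (rule ccontr)
        assume Pw: "gap n (deg P w) \<noteq> 0"
        have vt: "v \<noteq> t" using edge_ends[OF e] by simp
        have "\<exists>x\<in>V. x \<noteq> t \<and> gap n (deg P x) < gap n (deg Q x)"
        proof (rule ccontr)
          assume "\<not> ?thesis"
          then have le: "\<forall>x\<in>V - {t}. gap n (deg Q x) \<le> gap n (deg P x)"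
            by (auto simp: not_less)
          have Qt1: "gap n (deg Q t) = 1" using gap_low[OF Qt] bounded[OF Q tV] by simp
          let ?W = "V - {t}"
          have "(\<Sum>x\<in>?W - {v, w}. gap n (deg Q x)) \<le> (\<Sum>x\<in>?W - {v, w}. gap n (deg P x))"
            using le by (intro sum_mono) auto
          moreover have "(\<Sum>x\<in>V. g x) = g t + g v + g w + (\<Sum>x\<in>?W - {v, w}. g x)"
            for g :: "'a \<Rightarrow> nat"
          proof -
            have "(\<Sum>x\<in>V. g x) = g t + sum g ?W"
              using tV finite_V by (simp add: sum.remove)
            also have "sum g ?W = g v + sum g (?W - {v})"
              using step.prems vt finite_V by (intro sum.remove) auto
            also have "sum g (?W - {v}) = g w + sum g (?W - {v} - {w})"
              using step.prems tw finite_V by (intro sum.remove) auto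
            also have "?W - {v} - {w} = ?W - {v, w}" by auto
            finally show ?thesis by simp
          qed
          ultimately have "cost (\<lambda>_. gap n) Q < cost (\<lambda>_. gap n) P"
            unfolding cost_def using Pt Qv Qw Qt1 Pv Pw by simp
          then show False using optimal_cost_eq[OF P Q] by simp
        qed
        then obtain x where x: "x \<in> V" "x \<noteq> t" "gap n (deg P x) < gap n (deg Q x)" by blast
        obtain Q' y where pass: "passes (\<lambda>_. gap n) Q x Q' y"
          and smaller: "card (sym_diff Q' P) < card (sym_diff Q P)"
          using step_towards_better[OF unit_steps_gap refl Q optimal_sub[OF P] x(3)] by blast
        then have Q': "gap_optimal Q'" "gap n (deg Q' y) = gap n (deg Q y) + 1"
          "\<And>w. w \<noteq> x \<Longrightarrow> w \<noteq> y \<Longrightarrow> deg Q' w = deg Q w"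
          by (auto simp: passes_def)
        have "gap n (deg Q' t) > 0" using Q'(2,3) x(2) Qt by (cases "t = y") auto
        then have "gap n (deg P w) = 0"
          using less.hyps[OF _ P Pv Q'(1)] smaller by (simp add: Un_commute)
        then show False using Pw by simp
      qed
    qed
    obtain Q where "gap_optimal Q" "gap n (deg Q t) > 0"
      using bad_neighbour(2)[OF bounded _ _ e] step.prems by blast
    then show ?thesis using no_pair step.prems by blast
  qed
qed

section \<open>Each defect occupies an odd component without a factor\<close>

definition component_at :: "'a \<Rightarrow> 'a ugraph" where
  "component_at v = \<lparr>verts = {w. (v, w) \<in> (adj_rel G)\<^sup>*},
     edges = {e \<in> E. e \<subseteq> {w. (v, w) \<in> (adj_rel G)\<^sup>*}}\<rparr>"

lemma sym_reachable: "(u, v) \<in> (adj_rel H)\<^sup>* \<Longrightarrow> (v, u) \<in> (adj_rel H)\<^sup>*"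
proof -
  have "sym (adj_rel H)" by (auto simp: sym_def adj_rel_def insert_commute)
  then show "(u, v) \<in> (adj_rel H)\<^sup>* \<Longrightarrow> (v, u) \<in> (adj_rel H)\<^sup>*"
    by (meson sym_rtrancl symE)
qed

lemma reachable_in_V: "(v, w) \<in> (adj_rel G)\<^sup>* \<Longrightarrow> v \<in> V \<Longrightarrow> w \<in> V"
  by (induction rule: rtrancl_induct) (use edge_ends in \<open>auto simp: adj_rel_def\<close>)

lemma edge_in_component_at:
  assumes "e \<in> E"
  shows "e \<subseteq> verts (component_at v) \<or> e \<inter> verts (component_at v) = {}"
proof (cases "e \<inter> verts (component_at v) = {}")
  case False
  then obtain a where a: "a \<in> e" "(v, a) \<in> (adj_rel G)\<^sup>*" by (auto simp: component_at_def)
  obtain b where b: "e = {a, b}" using edge_at[OF assms a(1)] .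
  then have "(a, b) \<in> adj_rel G" using assms by (simp add: adj_rel_def)
  then have "(v, b) \<in> (adj_rel G)\<^sup>*" using a by simp
  then show ?thesis using a b by (simp add: component_at_def)
qed simp

lemma component_of_component_at:
  assumes v: "v \<in> V"
  shows "component_of (component_at v) G"
proof -
  let ?C = "component_at v"
  have sub: "subgraph ?C G"
    using reachable_in_V v card_edge
    by (auto simp: subgraph_def simple_graph_def component_at_def)
  have from_v: "(v, b) \<in> (adj_rel ?C)\<^sup>*" if "(v, b) \<in> (adj_rel G)\<^sup>*" for b
    using that
  proof (induction rule: rtrancl_induct)
    case (step y z)
    have "(v, z) \<in> (adj_rel G)\<^sup>*" using step(1,2) by simp
    then have "(y, z) \<in> adj_rel ?C"
      using step(1,2) by (auto simp: adj_rel_def component_at_def)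
    then show ?case using step.IH by simp
  qed simp
  have conn: "connected_graph ?C"
    unfolding connected_graph_def
  proof (intro conjI ballI)
    show "verts ?C \<noteq> {}" by (auto simp: component_at_def)
    fix a b assume "a \<in> verts ?C" "b \<in> verts ?C"
    then have "(v, a) \<in> (adj_rel ?C)\<^sup>*" "(v, b) \<in> (adj_rel ?C)\<^sup>*"
      using from_v by (auto simp: component_at_def)
    then show "(a, b) \<in> (adj_rel ?C)\<^sup>*" using sym_reachable rtrancl_trans by metis
  qed
  have "D = ?C" if D: "subgraph D G" "connected_graph D" "subgraph ?C D" for D
  proof -
    have "(adj_rel D)\<^sup>* \<subseteq> (adj_rel G)\<^sup>*"
      using D(1) by (intro rtrancl_mono) (auto simp: adj_rel_def subgraph_def)
    moreover have "v \<in> verts D"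
      using D(3) by (auto simp: subgraph_def component_at_def)
    ultimately have "verts D \<subseteq> verts ?C"
      using D(2) by (auto simp: connected_graph_def component_at_def)
    then have vs: "verts D = verts ?C" using D(3) by (auto simp: subgraph_def)
    have "edges D \<subseteq> edges ?C"
    proof
      fix e assume "e \<in> edges D"
      then have "e \<subseteq> verts ?C" "e \<in> E"
        using D(1) vs by (auto simp: subgraph_def simple_graph_def)
      then show "e \<in> edges ?C" by (simp add: component_at_def)
    qed
    then have "edges D = edges ?C" using D(3) by (auto simp: subgraph_def)
    then show ?thesis using vs by simp
  qed
  then show ?thesis using sub conn by (simp add: component_of_def)
qed

lemma even_degree_sum:
  assumes P: "P \<subseteq> E" and K: "K \<subseteq> V" "\<And>e. e \<in> P \<Longrightarrow> e \<subseteq> K \<or> e \<inter> K = {}"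
  shows "even (\<Sum>v\<in>K. deg P v)"
proof -
  have fin: "finite P" "finite K" using finite_sub[OF P] finite_V K(1) finite_subset by auto
  have "(\<Sum>v\<in>K. deg P v) = (\<Sum>v\<in>K. \<Sum>e\<in>P. if v \<in> e then 1 else 0)"
    using fin by (simp add: deg_def sum.If_cases Int_def)
  also have "\<dots> = (\<Sum>e\<in>P. \<Sum>v\<in>K. if v \<in> e then 1 else 0)"
    by (rule sum.swap)
  also have "\<dots> = (\<Sum>e\<in>P. card (K \<inter> e))"
    using fin by (simp add: sum.If_cases)
  also have "even \<dots>"
  proof (rule dvd_sum)
    fix e assume e: "e \<in> P"
    then have "K \<inter> e = e \<or> K \<inter> e = {}" using K(2) by blast
    then show "even (card (K \<inter> e))" using card_edge e P by fastforce
  qed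
  finally show ?thesis .
qed

text \<open>Every vertex \<open>w\<close> of the component is defective in some optimal subgraph (\<open>reachable_bad\<close>), hence
  has degree below \<open>2n\<close> in all of them (\<open>same_side\<close>); since \<open>P\<close> is allowed at \<open>w \<noteq> v\<close>, its degree
  there is odd.  This excludes the value \<open>2n\<close>, the one allowed degree that would spoil the parity
  count.\<close>

lemma bad_component:
  assumes n: "n \<ge> 1"
    and bounded: "\<And>Q v. gap_optimal Q \<Longrightarrow> v \<in> V \<Longrightarrow> deg Q v \<le> 2 * n"
    and P: "gap_optimal P" and v: "v \<in> V" and bad: "gap n (deg P v) > 0"
  shows "odd_component_of (component_at v) G \<and> \<not> has_H_factor n (component_at v)"
proof -
  let ?K = "verts (component_at v)"
  have KV: "?K \<subseteq> V" using reachable_in_V v by (auto simp: component_at_def)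
  have vK: "v \<in> ?K" by (simp add: component_at_def)
  have finK: "finite ?K" using KV finite_V finite_subset by blast
  have "odd (deg P w)" if "w \<in> ?K - {v}" for w
  proof -
    have wV: "w \<in> V" using that KV by blast
    have "gap n (deg P w) = 0"
      using one_bad_per_component[OF bounded _ v wV _ P bad] that by (auto simp: component_at_def)
    moreover have "(v, w) \<in> (adj_rel G)\<^sup>*" using that by (simp add: component_at_def)
    then obtain Q where Q: "gap_optimal Q" "gap n (deg Q w) > 0"
      using reachable_bad[OF bounded P bad] by blast
    have "deg P w < 2 * n"
      using same_side[OF Q(1) P wV Q(2)] gap_low[OF Q(2)] bounded[OF Q(1) wV] by blast
    ultimately show ?thesis by (auto simp: gap_def split: if_splits)
  qed
  then have "{w \<in> ?K - {v}. odd (deg P w)} = ?K - {v}" by blast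
  then have "even (\<Sum>w\<in>?K - {v}. deg P w) \<longleftrightarrow> even (card (?K - {v}))"
    using finK even_sum_iff[of "?K - {v}" "deg P"] by simp
  moreover have "even (\<Sum>w\<in>?K. deg P w)"
    using even_degree_sum[OF optimal_sub[OF P] KV] edge_in_component_at optimal_sub[OF P]
    by blast
  moreover have "(\<Sum>w\<in>?K. deg P w) = deg P v + (\<Sum>w\<in>?K - {v}. deg P w)"
    using sum.remove[OF finK vK] .
  moreover have "even (deg P v)" using gap_low[OF bad] bounded[OF P v] by blast
  moreover have "card ?K = Suc (card (?K - {v}))" using card.remove[OF finK vK] .
  ultimately have odd: "odd (card ?K)" by simp
  have "\<not> has_H_factor n (component_at v)"
  proof
    assume "has_H_factor n (component_at v)"
    then obtain F where F: "H_factor n F (component_at v)" by (auto simp: has_H_factor_def)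
    then have "edges F \<subseteq> edges (component_at v)"
      unfolding H_factor_def spanning_subgraph_def subgraph_def by blast
    then have FE: "edges F \<subseteq> E" and FK: "\<And>e. e \<in> edges F \<Longrightarrow> e \<subseteq> ?K"
      unfolding component_at_def by auto
    \<comment> \<open>The factor replaces \<open>P\<close> on the component and removes the defect at \<open>v\<close>.\<close>
    let ?Q = "edges F \<union> {e \<in> P. e \<inter> ?K = {}}"
    have QE: "?Q \<subseteq> E" using FE optimal_sub[OF P] by blast
    have inside: "gap n (deg ?Q w) = 0" if "w \<in> ?K" for w
    proof -
      have "{e \<in> ?Q. w \<in> e} = {e \<in> edges F. w \<in> e}" using that by blast
      then have "deg ?Q w = degree F w" by (simp add: deg_def degree_def)
      then show ?thesis using F that gap_eq_0_iff[OF n] by (simp add: H_factor_def)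
    qed
    have outside: "deg ?Q w = deg P w" if w: "w \<notin> ?K" for w
    proof -
      have disjoint: "e \<inter> ?K = {}" if e: "e \<in> P" "w \<in> e" for e
      proof -
        have "e \<in> E" using optimal_sub[OF P] e(1) by (rule subsetD)
        moreover have "\<not> e \<subseteq> ?K" using e(2) w by (meson subsetD)
        ultimately show ?thesis using edge_in_component_at by metis
      qed
      have avoid: "w \<notin> e" if "e \<in> edges F" for e
        using FK[OF that] w by (meson subsetD)
      have "{e \<in> ?Q. w \<in> e} = {e \<in> P. w \<in> e}"
        using disjoint avoid by auto
      then show ?thesis by (simp add: deg_def)
    qed
    have "gap n (deg ?Q w) \<le> gap n (deg P w)" for w
      using inside outside by (cases "w \<in> ?K") simp_all
    then have "cost (\<lambda>_. gap n) ?Q < cost (\<lambda>_. gap n) P"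
      unfolding cost_def using inside[OF vK] bad v
      by (intro sum_strict_mono_ex1[OF finite_V] ballI bexI[of _ v]) simp_all
    moreover have "cost (\<lambda>_. gap n) P \<le> cost (\<lambda>_. gap n) ?Q"
      using P QE unfolding optimal_def by blast
    ultimately show False by simp
  qed
  then show ?thesis
    using odd component_of_component_at[OF v] by (simp add: odd_component_of_def)
qed

lemma finite_components: "finite {C. odd_component_of C G \<and> \<not> has_H_factor n C}"
proof (rule finite_subset)
  show "{C. odd_component_of C G \<and> \<not> has_H_factor n C} \<subseteq>
      (\<lambda>(A, B). \<lparr>verts = A, edges = B\<rparr>) ` (Pow V \<times> Pow E)"
  proof
    fix C assume "C \<in> {C. odd_component_of C G \<and> \<not> has_H_factor n C}"
    then have "(verts C, edges C) \<in> Pow V \<times> Pow E"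
      by (auto simp: odd_component_of_def component_of_def subgraph_def)
    then show "C \<in> (\<lambda>(A, B). \<lparr>verts = A, edges = B\<rparr>) ` (Pow V \<times> Pow E)"
      by (rule rev_image_eqI) simp
  qed
  show "finite ((\<lambda>(A, B). \<lparr>verts = A, edges = B\<rparr>) ` (Pow V \<times> Pow E))"
    using finite_V finite_E by simp
qed

lemma cost_le_bad_components:
  assumes n: "n \<ge> 1"
    and bounded: "\<And>Q v. gap_optimal Q \<Longrightarrow> v \<in> V \<Longrightarrow> deg Q v \<le> 2 * n"
    and P: "gap_optimal P"
  shows "cost (\<lambda>_. gap n) P \<le> card {C. odd_component_of C G \<and> \<not> has_H_factor n C}"
proof -
  let ?B = "{v \<in> V. gap n (deg P v) > 0}"
  have "cost (\<lambda>_. gap n) P = (\<Sum>v\<in>?B. gap n (deg P v))"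
    unfolding cost_def using finite_V by (intro sum.mono_neutral_right) auto
  also have "\<dots> = (\<Sum>v\<in>?B. 1)"
    using gap_low bounded[OF P] by (intro sum.cong) auto
  also have "\<dots> = card ?B" by simp
  also have "\<dots> \<le> card {C. odd_component_of C G \<and> \<not> has_H_factor n C}"
  proof (rule card_inj_on_le[OF _ _ finite_components])
    show "inj_on component_at ?B"
    proof (rule inj_onI)
      fix v w assume vw: "v \<in> ?B" "w \<in> ?B" "component_at v = component_at w"
      have "w \<in> verts (component_at w)" by (simp add: component_at_def)
      then have "w \<in> verts (component_at v)" by (simp only: vw(3))
      then have "(v, w) \<in> (adj_rel G)\<^sup>*" by (simp add: component_at_def)
      then show "v = w" using one_bad_per_component[OF bounded _ _ _ _ P] vw by force
    qed
    show "component_at ` ?B \<subseteq> {C. odd_component_of C G \<and> \<not> has_H_factor n C}"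
      using bad_component[OF n bounded P] by auto
  qed
  finally show ?thesis .
qed

end

section \<open>Building the set of deleted vertices\<close>

lemma remove_verts_no_verts: "remove_verts G {} = G"
  by (cases G) (simp add: remove_verts_def)

text \<open>Each deleted vertex raises the minimum cost by at least \<open>2n\<close>, which pays for its contribution to
  \<open>2n|S|\<close>.  The bound \<open>k\<close> in place of the minimum cost lets the induction hypothesis absorb this
  increase.\<close>

lemma deficiency_attained:
  fixes G :: "'a ugraph"
  assumes "n \<ge> 1" "finite_simple_graph G"
    and "\<And>P. P \<subseteq> edges G \<Longrightarrow> k \<le> (\<Sum>v\<in>verts G. gap n (deg P v))"
  shows "\<exists>S\<subseteq>verts G. k + 2 * n * card S \<le>
    card {C. odd_component_of C (remove_verts G S) \<and> \<not> has_H_factor n C}"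
  using assms(2,3)
proof (induction "card (verts G)" arbitrary: G k rule: less_induct)
  case less
  interpret finite_graph G n by unfold_locales (fact less.prems(1))
  show ?case
  proof (cases "\<exists>T x. gap_optimal T \<and> x \<in> V \<and> deg T x > 2 * n")
    case True
    then obtain T x where T: "gap_optimal T" "x \<in> V" "deg T x > 2 * n" by blast
    let ?H = "remove_verts G {x}"
    have "card (verts ?H) < card (verts G)"
      using card_Diff1_less[OF finite_V T(2)] by (simp add: remove_verts_def)
    moreover have "finite_simple_graph ?H"
      using less.prems(1)
      by (auto simp: finite_simple_graph_def simple_graph_def remove_verts_def)
    moreover have "k + 2 * n \<le> (\<Sum>v\<in>verts ?H. gap n (deg P v))" if P: "P \<subseteq> edges ?H" for P
    proof -
      have PE: "P \<subseteq> E" and "{e \<in> P. x \<in> e} = {}" using P by (auto simp: remove_verts_def)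
      then have x0: "deg P x = 0" by (simp only: deg_def card.empty)
      have "k \<le> cost (\<lambda>_. gap n) T"
        using less.prems(2)[OF optimal_sub[OF T(1)]] by (simp add: cost_def)
      then have "k + 2 * n \<le> cost (linear_at x) P"
        using exceeding_vertex_bound[OF T(2,1,3) PE] by simp
      also have "\<dots> = (\<Sum>v\<in>V - {x}. linear_at x v (deg P v))"
        unfolding cost_def sum.remove[OF finite_V T(2)] using x0 by (simp add: linear_at_def)
      also have "\<dots> = (\<Sum>v\<in>verts ?H. gap n (deg P v))"
        by (intro sum.cong) (auto simp: linear_at_def remove_verts_def)
      finally show ?thesis .
    qed
    ultimately obtain S where S: "S \<subseteq> verts ?H" "k + 2 * n + 2 * n * card S \<le>
        card {C. odd_component_of C (remove_verts ?H S) \<and> \<not> has_H_factor n C}"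
      using less.hyps[of ?H "k + 2 * n"] by blast
    have SV: "S \<subseteq> V" "x \<notin> S" using S(1) by (auto simp: remove_verts_def)
    then have "card (insert x S) = Suc (card S)"
      using finite_V by (meson card_insert_disjoint finite_subset)
    moreover have "remove_verts ?H S = remove_verts G (insert x S)"
      by (auto simp: remove_verts_def)
    ultimately have "k + 2 * n * card (insert x S) \<le>
        card {C. odd_component_of C (remove_verts G (insert x S)) \<and> \<not> has_H_factor n C}"
      using S(2) by (simp add: algebra_simps)
    then show ?thesis using SV(1) T(2) by blast
  next
    case False
    obtain P where P: "gap_optimal P" using optimal_exists by blast
    have "k \<le> cost (\<lambda>_. gap n) P"
      using less.prems(2)[OF optimal_sub[OF P]] by (simp add: cost_def)
    also have "\<dots> \<le> card {C. odd_component_of C G \<and> \<not> has_H_factor n C}"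
      using cost_le_bad_components[OF assms(1) _ P] False by (meson not_less)
    finally show ?thesis by (intro exI[of _ "{}"]) (simp add: remove_verts_no_verts)
  qed
qed

theorem theorem2p5:
  fixes G :: "'a ugraph" and n :: nat
  assumes "n \<ge> 2"
    and "finite_simple_graph G"
    and "\<not> (\<exists>C. odd_component_of C G)"
    and "\<not> has_H_factor n G"
  shows "\<exists>S. S \<noteq> {} \<and> S \<subseteq> verts G \<and>
           card {C. odd_component_of C (remove_verts G S) \<and> \<not> has_H_factor n C}
             \<ge> 2 * n * card S + 1"
proof -
  have n: "n \<ge> 1" using assms(1) by simp
  have "1 \<le> (\<Sum>v\<in>verts G. gap n (deg P v))" if P: "P \<subseteq> edges G" for P
  proof (rule ccontr)
    assume "\<not> ?thesis"
    then have 0: "\<forall>v\<in>verts G. deg P v \<in> H_set n"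
      using assms(2) gap_eq_0_iff[OF n] by (auto simp: finite_simple_graph_def not_le)
    have "H_factor n \<lparr>verts = verts G, edges = P\<rparr> G"
      using P assms(2) 0
      by (auto simp: H_factor_def spanning_subgraph_def subgraph_def degree_def deg_def
          finite_simple_graph_def simple_graph_def)
    then show False using assms(4) by (auto simp: has_H_factor_def)
  qed
  from deficiency_attained[OF n assms(2) this] obtain S where S: "S \<subseteq> verts G"
    "1 + 2 * n * card S \<le>
      card {C. odd_component_of C (remove_verts G S) \<and> \<not> has_H_factor n C}"
    by blast
  have "S \<noteq> {}"
  proof
    assume "S = {}"
    then have "{C. odd_component_of C (remove_verts G S) \<and> \<not> has_H_factor n C} = {}"
      using assms(3) by (simp add: remove_verts_no_verts)
    then have "card {C. odd_component_of C (remove_verts G S) \<and> \<not> has_H_factor n C} = 0"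
      by (simp only: card.empty)
    then show False using S(2) by linarith
  qed
  then show ?thesis using S by auto
qed

end
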